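(* Let $G$ be a minimally nonperfectly divisible graph and $v\in V(G)$. Then: (1) $G$ has no nonempty basin and no nonempty simplicial set; (2) $N(v)$ has a subset $Y$ with $\alpha(G[Y])\ge 2$ and $\omega(G[N(v)\setminus Y])=\omega(G)-1$; (3) there exists a maximum clique $K$ of $G$ such that $v\in K$ and $N(v)\not\subseteq K$; (4) $|N(X)|\ge \omega(G)-\omega(G[X])$ for every nonempty subset $X\subseteq V(G)$; (5) $|N(v)|\ge \omega(G)+1$.
   Context: Graphs are finite and simple. $N(v)$ is the neighborhood of $v$; for $X\subseteq V(G)$, $N(X)=(\bigcup_{x\in X}N(x))\setminus X$ and $N[X]=N(X)\cup X$. A set $X\subseteq V(G)$ is a basin of $G$ if $\omega(G[N[X]])<\omega(G)$. A set $X$ is a simplicial set of $G$ if for every $x\in X$, the neighborhood of $x$ in $G$ is a clique. $\alpha$ denotes independence number. A perfect division of $G$ is a partition $(A,B)$ of $V(G)$ such that $G[A]$ is perfect and $\omega(G[B])<\omega(G)$. $G$ is perfectly divisible if every nonempty induced subgraph has a perfect division; $G$ is minimally nonperfectly divisible if $G$ is not perfectly divisible but every proper induced subgraph is. *)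

theory Defs
  imports "Graph_Theory.Digraph_Component"
begin

text \<open>
  Finite simple graphs are the symmetric, loop-free digraphs without parallel arcs of the
  locale \<^locale>\<open>graph\<close>; each edge is a pair of opposite arcs, \<open>u \<rightarrow>\<^bsub>G\<^esub> v\<close> is adjacency,
  and \<open>G \<restriction> X\<close> is the subgraph induced by \<open>X\<close>. The graph without vertices is allowed.
\<close>

definition nbrs :: "('a,'b) pre_digraph \<Rightarrow> 'a \<Rightarrow> 'a set" where
  "nbrs G v = {u. v \<rightarrow>\<^bsub>G\<^esub> u}"

definition set_nbrs :: "('a,'b) pre_digraph \<Rightarrow> 'a set \<Rightarrow> 'a set" where
  "set_nbrs G X = (\<Union>x\<in>X. nbrs G x) - X"

definition closed_set_nbrs :: "('a,'b) pre_digraph \<Rightarrow> 'a set \<Rightarrow> 'a set" where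
  "closed_set_nbrs G X = set_nbrs G X \<union> X"

definition is_clique :: "('a,'b) pre_digraph \<Rightarrow> 'a set \<Rightarrow> bool" where
  "is_clique G K \<longleftrightarrow> K \<subseteq> verts G \<and> (\<forall>u\<in>K. \<forall>v\<in>K. u \<noteq> v \<longrightarrow> u \<rightarrow>\<^bsub>G\<^esub> v)"

definition is_independent :: "('a,'b) pre_digraph \<Rightarrow> 'a set \<Rightarrow> bool" where
  "is_independent G S \<longleftrightarrow> S \<subseteq> verts G \<and> (\<forall>u\<in>S. \<forall>v\<in>S. \<not> u \<rightarrow>\<^bsub>G\<^esub> v)"

text \<open>
  In a graph, the sets below are finite, and nonempty because the empty set is a clique
  and an independent set; both numbers are \<open>0\<close> exactly for the graph without vertices.
\<close>

definition clique_number :: "('a,'b) pre_digraph \<Rightarrow> nat" where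
  "clique_number G = Max (card ` {K. is_clique G K})"

definition independence_number :: "('a,'b) pre_digraph \<Rightarrow> nat" where
  "independence_number G = Max (card ` {S. is_independent G S})"

definition maximum_clique :: "('a,'b) pre_digraph \<Rightarrow> 'a set \<Rightarrow> bool" where
  "maximum_clique G K \<longleftrightarrow> is_clique G K \<and> card K = clique_number G"

definition proper_colouring :: "('a,'b) pre_digraph \<Rightarrow> nat \<Rightarrow> ('a \<Rightarrow> nat) \<Rightarrow> bool" where
  "proper_colouring G k c \<longleftrightarrow>
     (\<forall>v\<in>verts G. c v < k) \<and> (\<forall>u\<in>verts G. \<forall>v\<in>verts G. u \<rightarrow>\<^bsub>G\<^esub> v \<longrightarrow> c u \<noteq> c v)"

definition chromatic_number :: "('a,'b) pre_digraph \<Rightarrow> nat" where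
  "chromatic_number G = (LEAST k. \<exists>c. proper_colouring G k c)"

definition perfect_graph :: "('a,'b) pre_digraph \<Rightarrow> bool" where
  "perfect_graph G \<longleftrightarrow>
     (\<forall>X. X \<subseteq> verts G \<longrightarrow> chromatic_number (G \<restriction> X) = clique_number (G \<restriction> X))"

text \<open>
  A part of a perfect division may be empty: for a perfect graph with at least one vertex,
  \<open>(verts G, {})\<close> is one.
\<close>

definition perfect_division :: "('a,'b) pre_digraph \<Rightarrow> 'a set \<Rightarrow> 'a set \<Rightarrow> bool" where
  "perfect_division G A B \<longleftrightarrow>
     A \<union> B = verts G \<and> A \<inter> B = {} \<and>
     perfect_graph (G \<restriction> A) \<and> clique_number (G \<restriction> B) < clique_number G"

definition perfectly_divisible :: "('a,'b) pre_digraph \<Rightarrow> bool" where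
  "perfectly_divisible G \<longleftrightarrow>
     (\<forall>X. X \<subseteq> verts G \<and> X \<noteq> {} \<longrightarrow> (\<exists>A B. perfect_division (G \<restriction> X) A B))"

definition minimally_nonperfectly_divisible :: "('a,'b) pre_digraph \<Rightarrow> bool" where
  "minimally_nonperfectly_divisible G \<longleftrightarrow>
     \<not> perfectly_divisible G \<and> (\<forall>X. X \<subset> verts G \<longrightarrow> perfectly_divisible (G \<restriction> X))"

definition basin :: "('a,'b) pre_digraph \<Rightarrow> 'a set \<Rightarrow> bool" where
  "basin G X \<longleftrightarrow>
     X \<subseteq> verts G \<and> clique_number (G \<restriction> closed_set_nbrs G X) < clique_number G"

definition simplicial_set :: "('a,'b) pre_digraph \<Rightarrow> 'a set \<Rightarrow> bool" where
  "simplicial_set G X \<longleftrightarrow> X \<subseteq> verts G \<and> (\<forall>x\<in>X. is_clique G (nbrs G x))"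

end

theory Submission
  imports Defs
begin

text \<open>
  A minimally nonperfectly divisible graph \<open>G\<close> has no perfect division, but \<open>G - X\<close> has one,
  \<open>(A, B)\<close>, for every nonempty \<open>X\<close>. If \<open>X\<close> were a basin, \<open>(A, B \<union> X)\<close> would be a perfect division
  of \<open>G\<close>; if \<open>x\<close> were simplicial in \<open>G[A \<union> {x}]\<close>, then \<open>(A \<union> {x}, B)\<close> would be one for \<open>X = {x}\<close>,
  since adding a simplicial vertex preserves perfection. For \<open>X = {v}\<close> this forces a clique of
  size \<open>\<omega>(G) - 1\<close> in \<open>N(v) \<inter> B\<close> and two nonadjacent vertices in \<open>Y = N(v) \<inter> A\<close>.
\<close>

section \<open>Induced subgraphs, cliques and clique numbers\<close>

lemma adj_induce_subgraph_iff:
  "u \<rightarrow>\<^bsub>G \<restriction> X\<^esub> w \<longleftrightarrow> u \<in> X \<and> w \<in> X \<and> u \<rightarrow>\<^bsub>G\<^esub> w"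
  by (auto simp: induce_subgraph_def arcs_ends_def arc_to_ends_def image_iff)

lemma induce_induce_subgraph:
  assumes "Y \<subseteq> X"
  shows "(G \<restriction> X) \<restriction> Y = G \<restriction> Y"
  using assms by (auto simp: induce_subgraph_def)

lemma (in wf_digraph) induce_subgraph_self: "G \<restriction> verts G = G"
  by (intro pre_digraph.equality) (auto simp: induce_subgraph_def)

lemma is_clique_induce_subgraph_iff:
  assumes "X \<subseteq> verts G"
  shows "is_clique (G \<restriction> X) K \<longleftrightarrow> is_clique G K \<and> K \<subseteq> X"
  using assms unfolding is_clique_def by (auto simp: adj_induce_subgraph_iff)

lemma (in sym_digraph) is_clique_insert_nbrs:
  assumes "is_clique G L" "L \<subseteq> nbrs G x" "x \<in> verts G"
  shows "is_clique G (insert x L)"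
  unfolding is_clique_def
proof (intro conjI ballI impI)
  show "insert x L \<subseteq> verts G" using assms unfolding is_clique_def by blast
  have adj: "x \<rightarrow>\<^bsub>G\<^esub> w" if "w \<in> L" for w using assms(2) that unfolding nbrs_def by blast
  show "u \<rightarrow>\<^bsub>G\<^esub> w" if "u \<in> insert x L" "w \<in> insert x L" "u \<noteq> w" for u w
    using that adj assms(1) graph_symmetric unfolding is_clique_def by blast
qed

lemma is_clique_subset: "is_clique G K \<Longrightarrow> L \<subseteq> K \<Longrightarrow> is_clique G L"
  unfolding is_clique_def by blast

lemma finite_cliques:
  assumes "finite (verts G)"
  shows "finite {K. is_clique G K}"
  using assms by (rule finite_subset[OF _ finite_Pow_iff[THEN iffD2], rotated])
    (auto simp: is_clique_def)

lemma is_clique_empty: "is_clique G {}"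
  by (simp add: is_clique_def)

lemma card_clique_le_clique_number:
  assumes "finite (verts G)" "is_clique G K"
  shows "card K \<le> clique_number G"
  unfolding clique_number_def using assms finite_cliques by (intro Max_ge) auto

lemma clique_number_attained:
  assumes "finite (verts G)"
  obtains K where "is_clique G K" "card K = clique_number G"
proof -
  have "clique_number G \<in> card ` {K. is_clique G K}"
    unfolding clique_number_def using assms finite_cliques is_clique_empty
    by (intro Max_in) auto
  then show ?thesis using that by auto
qed

lemma clique_number_induce_attained:
  assumes "finite (verts G)" "X \<subseteq> verts G"
  obtains K where "is_clique G K" "K \<subseteq> X" "card K = clique_number (G \<restriction> X)"
proof -
  have "finite (verts (G \<restriction> X))" using assms finite_subset by auto
  then show ?thesis
    using that clique_number_attained is_clique_induce_subgraph_iff[OF assms(2)] by metis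
qed

lemma card_clique_le_clique_number_induce:
  assumes "finite (verts G)" "X \<subseteq> verts G" "is_clique G K" "K \<subseteq> X"
  shows "card K \<le> clique_number (G \<restriction> X)"
  using assms by (intro card_clique_le_clique_number)
    (auto simp: is_clique_induce_subgraph_iff intro: finite_subset)

lemma clique_number_induce_mono:
  assumes "finite (verts G)" "Y \<subseteq> verts G" "X \<subseteq> Y"
  shows "clique_number (G \<restriction> X) \<le> clique_number (G \<restriction> Y)"
  using assms clique_number_induce_attained[OF assms(1), of X]
    card_clique_le_clique_number_induce[OF assms(1,2)]
  by (metis order_trans)

lemma (in fin_digraph) clique_number_induce_le:
  assumes "X \<subseteq> verts G"
  shows "clique_number (G \<restriction> X) \<le> clique_number G"
  using clique_number_induce_mono[OF finite_verts subset_refl assms]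
  by (simp add: induce_subgraph_self)

section \<open>Colourings and perfect graphs\<close>

lemma proper_colouring_mono:
  "proper_colouring G k c \<Longrightarrow> k \<le> l \<Longrightarrow> proper_colouring G l c"
  unfolding proper_colouring_def by fastforce

lemma clique_number_le_colours:
  assumes "finite (verts G)" "proper_colouring G k c"
  shows "clique_number G \<le> k"
proof -
  obtain K where K: "is_clique G K" "card K = clique_number G"
    using clique_number_attained[OF assms(1)] .
  have "inj_on c K"
    using K(1) assms(2) unfolding inj_on_def is_clique_def proper_colouring_def by blast
  moreover have "c ` K \<subseteq> {..<k}"
    using K(1) assms(2) unfolding is_clique_def proper_colouring_def by auto
  ultimately show ?thesis
    using K(2) card_inj_on_le[of c K "{..<k}"] by simp
qed

text \<open>Replaces the \<open>LEAST\<close> in \<open>chromatic_number\<close> by the existence of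
  a single colouring. This suffices because a proper colouring is injective on cliques, so
  \<open>clique_number G\<close> is always a lower bound for the number of colours.\<close>

lemma chromatic_eq_clique_number_iff:
  assumes "loopfree_digraph G" "finite (verts G)"
  shows "chromatic_number G = clique_number G \<longleftrightarrow> (\<exists>c. proper_colouring G (clique_number G) c)"
proof
  interpret loopfree_digraph G by fact
  \<comment> \<open>An injective numbering of the vertices is a proper colouring, as there are no
    loops. Some colouring must exist before \<open>LEAST\<close> can be known to be
    attained.\<close>
  obtain h :: "'a \<Rightarrow> nat" and n where "inj_on h (verts G)" "h ` verts G = {i. i < n}"
    using finite_imp_inj_to_nat_seg[OF assms(2)] by metis
  then have "proper_colouring G n h"
    unfolding proper_colouring_def inj_on_def using adj_not_same by blast
  then have "\<exists>k c. proper_colouring G k c" by blast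
  then have "\<exists>c. proper_colouring G (chromatic_number G) c"
    unfolding chromatic_number_def by (rule LeastI_ex)
  then show "\<exists>c. proper_colouring G (clique_number G) c"
    if "chromatic_number G = clique_number G" using that by simp
next
  assume "\<exists>c. proper_colouring G (clique_number G) c"
  then show "chromatic_number G = clique_number G"
    unfolding chromatic_number_def
    using clique_number_le_colours[OF assms(2)] by (intro Least_equality) auto
qed

text \<open>The working form of perfection: nested restrictions collapse to restrictions of
  \<open>G\<close>, and only colourings remain to be exhibited.\<close>

lemma (in graph) perfect_graph_induce_iff:
  assumes "A \<subseteq> verts G"
  shows "perfect_graph (G \<restriction> A) \<longleftrightarrow>
    (\<forall>X\<subseteq>A. \<exists>c. proper_colouring (G \<restriction> X) (clique_number (G \<restriction> X)) c)"
proof -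
  have "chromatic_number (G \<restriction> X) = clique_number (G \<restriction> X) \<longleftrightarrow>
      (\<exists>c. proper_colouring (G \<restriction> X) (clique_number (G \<restriction> X)) c)" if "X \<subseteq> A" for X
  proof (rule chromatic_eq_clique_number_iff)
    have "X \<subseteq> verts G" using that assms by blast
    then show "finite (verts (G \<restriction> X))" by (auto intro: finite_subset)
    show "loopfree_digraph (G \<restriction> X)"
      by unfold_locales (auto simp: induce_subgraph_def no_loops)
  qed
  then show ?thesis
    unfolding perfect_graph_def by (auto simp: induce_induce_subgraph)
qed

text \<open>Together with \<open>x\<close>, the neighbours of \<open>x\<close> in \<open>X\<close>
  form a clique, which has at most \<open>k\<close> vertices. So these neighbours occupy fewer than
  \<open>k\<close> colours and one is left over for \<open>x\<close>.\<close>

lemma (in graph) colouring_insert_simplicial: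
  assumes X: "X \<subseteq> verts G" and x: "x \<in> X"
    and clique: "is_clique G (nbrs G x \<inter> X)"
    and c: "proper_colouring (G \<restriction> (X - {x})) k c"
    and k: "clique_number (G \<restriction> X) \<le> k"
  shows "\<exists>c'. proper_colouring (G \<restriction> X) k c'"
proof -
  let ?N = "nbrs G x \<inter> X"
  have fin: "finite ?N" using X finite_subset[OF _ finite_verts] by blast
  have x_notin: "x \<notin> ?N" by (auto simp: nbrs_def dest: adj_not_same)
  have "is_clique G (insert x ?N)"
    using clique X x by (intro is_clique_insert_nbrs) auto
  then have "card (insert x ?N) \<le> clique_number (G \<restriction> X)"
    using X x by (intro card_clique_le_clique_number_induce) auto
  then have "card ?N < k" using fin x_notin k by simp
  then have "card (c ` ?N) < card {..<k}"
    using card_image_le[OF fin, of c] by simp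
  then obtain i where i: "i < k" "i \<notin> c ` ?N"
    by (metis card_mono finite_imageI[OF fin] lessThan_iff not_le subsetI)
  have new: "c w \<noteq> i" if "w \<in> X" "x \<rightarrow>\<^bsub>G\<^esub> w" for w
    using i(2) that unfolding nbrs_def by blast
  have old: "c u \<noteq> c w" if "u \<in> X - {x}" "w \<in> X - {x}" "u \<rightarrow>\<^bsub>G\<^esub> w" for u w
    using c that unfolding proper_colouring_def by (simp add: adj_induce_subgraph_iff)
  \<comment> \<open>Edges avoiding \<open>x\<close> are handled by \<open>old\<close>, edges at
    \<open>x\<close> by \<open>new\<close>, in either direction by symmetry. The case where both
    ends are \<open>x\<close> would be a loop.\<close>
  have "(c(x := i)) u \<noteq> (c(x := i)) w" if "u \<in> X" "w \<in> X" "u \<rightarrow>\<^bsub>G\<^esub> w" for u w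
    using new[of u] new[of w] old[of u w] that adj_not_same[of x] graph_symmetric[of u w]
    by (cases "u = x"; cases "w = x") auto
  then have "proper_colouring (G \<restriction> X) k (c(x := i))"
    using c i(1) unfolding proper_colouring_def by (simp add: adj_induce_subgraph_iff)
  then show ?thesis by blast
qed

text \<open>Only sets \<open>X\<close> containing \<open>x\<close> are new. For these,
  \<open>X - {x}\<close> lies in \<open>A\<close> and is coloured by perfection, and the colouring
  extends to \<open>x\<close>, which is still simplicial in \<open>X\<close>.\<close>

lemma (in graph) perfect_insert_simplicial:
  assumes A: "A \<subseteq> verts G" and x: "x \<in> verts G"
    and perf: "perfect_graph (G \<restriction> A)"
    and clique: "is_clique G (nbrs G x \<inter> A)"
  shows "perfect_graph (G \<restriction> insert x A)"
proof -
  have "\<exists>c. proper_colouring (G \<restriction> X) (clique_number (G \<restriction> X)) c" if "X \<subseteq> insert x A" for X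
  proof (cases "x \<in> X")
    case True
    have XV: "X \<subseteq> verts G" using that A x by blast
    have "X - {x} \<subseteq> A" using that by blast
    then obtain c where
      "proper_colouring (G \<restriction> (X - {x})) (clique_number (G \<restriction> (X - {x}))) c"
      using perf perfect_graph_induce_iff[OF A] by blast
    then have "proper_colouring (G \<restriction> (X - {x})) (clique_number (G \<restriction> X)) c"
      using clique_number_induce_mono[OF finite_verts XV] by (rule proper_colouring_mono) auto
    \<comment> \<open>Since \<open>x\<close> is not its own neighbour, its neighbours in
      \<open>X\<close> all lie in \<open>A\<close>.\<close>
    moreover have "is_clique G (nbrs G x \<inter> X)"
      using clique that by (elim is_clique_subset) (auto simp: nbrs_def dest: adj_not_same)
    ultimately show ?thesis
      using XV True by (intro colouring_insert_simplicial) auto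
  next
    case False
    then show ?thesis using that perf perfect_graph_induce_iff[OF A] by blast
  qed
  then show ?thesis using A x by (subst perfect_graph_induce_iff) auto
qed

section \<open>Perfect divisions under minimality\<close>

lemma (in wf_digraph) minimally_nonperfectly_divisible_no_division:
  assumes "minimally_nonperfectly_divisible G"
  shows "\<not> perfect_division G A B"
proof
  assume div: "perfect_division G A B"
  have "\<exists>A B. perfect_division (G \<restriction> X) A B" if X: "X \<subseteq> verts G" "X \<noteq> {}" for X
  proof (cases "X = verts G")
    case True
    then show ?thesis using div induce_subgraph_self by metis
  next
    case False
    then have "perfectly_divisible (G \<restriction> X)"
      using assms X unfolding minimally_nonperfectly_divisible_def by blast
    \<comment> \<open>Perfect divisibility of the proper subgraph on \<open>X\<close> is applied to
      its full vertex set. Hence all nonempty induced subgraphs have a division, against the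
      nondivisibility of \<open>G\<close>.\<close>
    then have "\<exists>A B. perfect_division ((G \<restriction> X) \<restriction> X) A B"
      using X(2) unfolding perfectly_divisible_def by simp
    then show ?thesis by (simp add: induce_induce_subgraph)
  qed
  then show False
    using assms unfolding minimally_nonperfectly_divisible_def perfectly_divisible_def by blast
qed

text \<open>Divides what is left after deleting \<open>X\<close>, with the clique number of
  \<open>B\<close> compared with that of the whole \<open>G\<close>. This is the form needed when
  the deleted vertices are put back into one of the parts.\<close>

lemma (in graph) minimally_nonperfectly_divisible_remove:
  assumes "minimally_nonperfectly_divisible G" "X \<subseteq> verts G" "X \<noteq> {}"
  obtains A B where "A \<union> B = verts G - X" "A \<inter> B = {}" "perfect_graph (G \<restriction> A)"
    "clique_number (G \<restriction> B) < clique_number G"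
proof (cases "X = verts G")
  \<comment> \<open>Nothing is left, and perfect divisibility speaks of nonempty subgraphs only, so
    two empty parts are supplied directly.\<close>
  case True
  obtain x where x: "x \<in> verts G" using assms by blast
  then have "is_clique G {x}" by (simp add: is_clique_def)
  then have "0 < clique_number G"
    using card_clique_le_clique_number[OF finite_verts] by fastforce
  moreover have empty: "clique_number (G \<restriction> {}) = 0"
    using clique_number_induce_attained[OF finite_verts, of "{}"]
    by (metis card.empty empty_subsetI subset_empty)
  moreover have "perfect_graph (G \<restriction> {})"
    by (subst perfect_graph_induce_iff) (auto simp: proper_colouring_def)
  ultimately show ?thesis using that[of "{}" "{}"] True by simp
next
  case False
  let ?R = "verts G - X"
  have R: "?R \<subset> verts G" "?R \<noteq> {}" using False assms by auto
  then have "perfectly_divisible (G \<restriction> ?R)"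
    using assms(1) unfolding minimally_nonperfectly_divisible_def by blast
  then have "\<exists>A B. perfect_division ((G \<restriction> ?R) \<restriction> ?R) A B"
    using R(2) unfolding perfectly_divisible_def by simp
  then obtain A B where "perfect_division (G \<restriction> ?R) A B"
    by (auto simp: induce_induce_subgraph)
  then have AB: "A \<union> B = ?R" "A \<inter> B = {}" "perfect_graph ((G \<restriction> ?R) \<restriction> A)"
    "clique_number ((G \<restriction> ?R) \<restriction> B) < clique_number (G \<restriction> ?R)"
    unfolding perfect_division_def by auto
  have "A \<subseteq> ?R" "B \<subseteq> ?R" using AB(1) by auto
  then show ?thesis
    using that[OF AB(1,2)] AB(3,4) clique_number_induce_le[of ?R]
    by (simp add: induce_induce_subgraph)
qed

text \<open>A clique inside \<open>B \<union> X\<close> either avoids \<open>X\<close> and lies in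
  \<open>B\<close>, or meets \<open>X\<close> and then lies in the closed neighbourhood of
  \<open>X\<close>. For a basin, both alternatives make it smaller than
  \<open>clique_number G\<close>.\<close>

lemma (in graph) minimally_nonperfectly_divisible_no_basin:
  assumes mnpd: "minimally_nonperfectly_divisible G" and "X \<noteq> {}"
  shows "\<not> basin G X"
proof
  assume "basin G X"
  then have X: "X \<subseteq> verts G"
    and less: "clique_number (G \<restriction> closed_set_nbrs G X) < clique_number G"
    unfolding basin_def by auto
  obtain A B where AB: "A \<union> B = verts G - X" "A \<inter> B = {}" "perfect_graph (G \<restriction> A)"
    "clique_number (G \<restriction> B) < clique_number G"
    using minimally_nonperfectly_divisible_remove[OF mnpd X assms(2)] .
  have BX: "B \<union> X \<subseteq> verts G" using AB(1) X by blast
  have N: "closed_set_nbrs G X \<subseteq> verts G"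
    using X by (auto simp: closed_set_nbrs_def set_nbrs_def nbrs_def)
  obtain K where K: "is_clique G K" "K \<subseteq> B \<union> X" "card K = clique_number (G \<restriction> (B \<union> X))"
    using clique_number_induce_attained[OF finite_verts BX] .
  have "card K < clique_number G"
  proof (cases "K \<inter> X = {}")
    case True
    then have "card K \<le> clique_number (G \<restriction> B)"
      using K BX by (intro card_clique_le_clique_number_induce) auto
    then show ?thesis using AB(4) by simp
  next
    case False
    then obtain x where x: "x \<in> K" "x \<in> X" by blast
    have "y \<in> closed_set_nbrs G X" if "y \<in> K" for y
    proof (cases "y = x")
      case False
      then have "y \<in> nbrs G x"
        using K(1) x(1) that unfolding is_clique_def nbrs_def by simp
      then show ?thesis using x(2) unfolding closed_set_nbrs_def set_nbrs_def by blast
    qed (simp add: x(2) closed_set_nbrs_def)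
    then have "K \<subseteq> closed_set_nbrs G X" by blast
    then have "card K \<le> clique_number (G \<restriction> closed_set_nbrs G X)"
      using K(1) N by (intro card_clique_le_clique_number_induce) auto
    then show ?thesis using less by simp
  qed
  then have "perfect_division G A (B \<union> X)"
    using AB K(3) X unfolding perfect_division_def by auto
  then show False using minimally_nonperfectly_divisible_no_division[OF mnpd] by blast
qed

text \<open>The common source of all claims except the ones on basins and on
  \<open>set_nbrs G X\<close>. The vertex \<open>v\<close> can be returned to neither part of a
  division of \<open>G - v\<close>: failure for \<open>A\<close> gives \<open>Y\<close>, failure for
  \<open>B\<close> gives \<open>K\<close>.\<close>

lemma (in graph) minimally_nonperfectly_divisible_nbrs_split:
  assumes mnpd: "minimally_nonperfectly_divisible G" and v: "v \<in> verts G"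
  obtains Y K where "Y \<subseteq> nbrs G v" "\<not> is_clique G Y"
    "is_clique G K" "K \<subseteq> nbrs G v - Y" "card K = clique_number G - 1"
proof -
  obtain A B where AB: "A \<union> B = verts G - {v}" "A \<inter> B = {}" "perfect_graph (G \<restriction> A)"
    "clique_number (G \<restriction> B) < clique_number G"
    using minimally_nonperfectly_divisible_remove[OF mnpd, of "{v}"] v by auto
  have sub: "A \<subseteq> verts G" "insert v B \<subseteq> verts G" using AB(1) v by auto
  have "\<not> is_clique G (nbrs G v \<inter> A)"
  proof
    assume "is_clique G (nbrs G v \<inter> A)"
    then have "perfect_graph (G \<restriction> insert v A)"
      using AB(3) sub v by (intro perfect_insert_simplicial) auto
    then have "perfect_division G (insert v A) B"
      using AB v unfolding perfect_division_def by auto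
    then show False using minimally_nonperfectly_divisible_no_division[OF mnpd] by blast
  qed
  moreover have "\<not> clique_number (G \<restriction> insert v B) < clique_number G"
  proof
    assume "clique_number (G \<restriction> insert v B) < clique_number G"
    then have "perfect_division G A (insert v B)"
      using AB v unfolding perfect_division_def by auto
    then show False using minimally_nonperfectly_divisible_no_division[OF mnpd] by blast
  qed
  then have eq: "clique_number (G \<restriction> insert v B) = clique_number G"
    using clique_number_induce_le[OF sub(2)] by simp
  obtain K where K: "is_clique G K" "K \<subseteq> insert v B" "card K = clique_number G"
    using clique_number_induce_attained[OF finite_verts sub(2)] eq by metis
  \<comment> \<open>Without \<open>v\<close>, the maximum clique \<open>K\<close> would fit into
    \<open>B\<close>, whose clique number is too small.\<close>
  have "v \<in> K"
  proof (rule ccontr)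
    assume "v \<notin> K"
    then have "card K \<le> clique_number (G \<restriction> B)"
      using K sub by (intro card_clique_le_clique_number_induce) auto
    then show False using AB(4) K(3) by simp
  qed
  \<comment> \<open>The rest of \<open>K\<close> lies in \<open>B\<close>, hence outside
    \<open>A\<close>, and is adjacent to \<open>v\<close>.\<close>
  then have "K - {v} \<subseteq> nbrs G v - nbrs G v \<inter> A" "card (K - {v}) = clique_number G - 1"
    using K AB(2) unfolding is_clique_def nbrs_def by auto
  moreover have "is_clique G (K - {v})" using K(1) by (rule is_clique_subset) auto
  ultimately show ?thesis using that[of "nbrs G v \<inter> A" "K - {v}"] by blast
qed

lemma (in graph) independence_number_induce_ge_2:
  assumes "Y \<subseteq> verts G" "\<not> is_clique G Y"
  shows "2 \<le> independence_number (G \<restriction> Y)"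
proof -
  obtain a b where ab: "a \<in> Y" "b \<in> Y" "a \<noteq> b" "\<not> a \<rightarrow>\<^bsub>G\<^esub> b"
    using assms unfolding is_clique_def by blast
  have "is_independent (G \<restriction> Y) {a, b}"
    using ab adj_not_same[of a] adj_not_same[of b] graph_symmetric[of b a]
    by (auto simp: is_independent_def adj_induce_subgraph_iff)
  moreover have "finite {S. is_independent (G \<restriction> Y) S}"
    using finite_subset[OF assms(1) finite_verts]
    by (rule finite_subset[OF _ finite_Pow_iff[THEN iffD2], rotated])
      (auto simp: is_independent_def)
  ultimately have "card {a, b} \<le> independence_number (G \<restriction> Y)"
    unfolding independence_number_def by (intro Max_ge) auto
  then show ?thesis using ab(3) by simp
qed

theorem theorem5:
  fixes G :: "('a,'b) pre_digraph" and v :: 'a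
  assumes "graph G"
    and "minimally_nonperfectly_divisible G"
    and "v \<in> verts G"
  shows "(\<not> (\<exists>X. X \<noteq> {} \<and> basin G X) \<and> \<not> (\<exists>X. X \<noteq> {} \<and> simplicial_set G X)) \<and>
    (\<exists>Y. Y \<subseteq> nbrs G v \<and> independence_number (G \<restriction> Y) \<ge> 2 \<and>
         clique_number (G \<restriction> (nbrs G v - Y)) = clique_number G - 1) \<and>
    (\<exists>K. maximum_clique G K \<and> v \<in> K \<and> \<not> nbrs G v \<subseteq> K) \<and>
    (\<forall>X. X \<subseteq> verts G \<and> X \<noteq> {} \<longrightarrow>
         card (set_nbrs G X) \<ge> clique_number G - clique_number (G \<restriction> X)) \<and>
    card (nbrs G v) \<ge> clique_number G + 1"
proof -
  interpret graph G by fact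
  note mnpd = \<open>minimally_nonperfectly_divisible G\<close>
  have no_simplicial: "\<not> simplicial_set G X" if ne: "X \<noteq> {}" for X
  proof
    assume simp: "simplicial_set G X"
    obtain x where x: "x \<in> X" using ne by blast
    then have "x \<in> verts G" and clique: "is_clique G (nbrs G x)"
      using simp unfolding simplicial_set_def by auto
    then obtain Y where "Y \<subseteq> nbrs G x" "\<not> is_clique G Y"
      using minimally_nonperfectly_divisible_nbrs_split[OF mnpd] by metis
    \<comment> \<open>A single simplicial vertex is contradictory: its neighbourhood would be a
      clique with a non-clique subset.\<close>
    then show False using clique is_clique_subset by blast
  qed
  obtain Y K where Y: "Y \<subseteq> nbrs G v" "\<not> is_clique G Y"
    and K: "is_clique G K" "K \<subseteq> nbrs G v - Y" "card K = clique_number G - 1"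
    using minimally_nonperfectly_divisible_nbrs_split[OF mnpd \<open>v \<in> verts G\<close>] .
  have N: "nbrs G v \<subseteq> verts G" by (auto simp: nbrs_def)
  have finN: "finite (nbrs G v)" using N finite_verts by (rule finite_subset)
  have "v \<notin> nbrs G v" by (auto simp: nbrs_def dest: adj_not_same)
  have insert_clique: "is_clique G (insert v L)" if "is_clique G L" "L \<subseteq> nbrs G v" for L
    using that \<open>v \<in> verts G\<close> by (rule is_clique_insert_nbrs)
  have card_insert: "card (insert v L) = Suc (card L)" if "L \<subseteq> nbrs G v" for L
    using that finite_subset[OF that finN] \<open>v \<notin> nbrs G v\<close> by (auto simp: card_insert_if)
  have card_less: "card L < clique_number G" if "is_clique G L" "L \<subseteq> nbrs G v" for L
    using card_clique_le_clique_number[OF finite_verts insert_clique[OF that]]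
      card_insert[OF that(2)] by simp
  \<comment> \<open>Forces \<open>clique_number G\<close> to be positive, so the natural-number
    subtraction in \<open>clique_number G - 1\<close> is exact.\<close>
  have Kless: "card K < clique_number G" using card_less K by blast
  have "clique_number (G \<restriction> (nbrs G v - Y)) = clique_number G - 1"
  proof (rule antisym)
    obtain L where "is_clique G L" "L \<subseteq> nbrs G v - Y"
      "card L = clique_number (G \<restriction> (nbrs G v - Y))"
      using N
      by (elim clique_number_induce_attained[OF finite_verts, of "nbrs G v - Y", rotated]) auto
    \<comment> \<open>Any clique among the neighbours of \<open>v\<close> grows by one when
      \<open>v\<close> is added.\<close>
    then show "clique_number (G \<restriction> (nbrs G v - Y)) \<le> clique_number G - 1"
      using card_less[of L] by fastforce
    show "clique_number G - 1 \<le> clique_number (G \<restriction> (nbrs G v - Y))"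
      using K N card_clique_le_clique_number_induce[OF finite_verts, of "nbrs G v - Y" K] by auto
  qed
  moreover have "2 \<le> independence_number (G \<restriction> Y)"
    using Y N by (intro independence_number_induce_ge_2) auto
  moreover have "maximum_clique G (insert v K)"
    using insert_clique[of K] card_insert[of K] K Kless unfolding maximum_clique_def by auto
  moreover have "Y \<noteq> {}" using Y(2) is_clique_empty by metis
  \<comment> \<open>A vertex of \<open>Y\<close> is a neighbour of \<open>v\<close> outside
    \<open>K\<close> and different from \<open>v\<close>.\<close>
  then have "\<not> nbrs G v \<subseteq> insert v K" using Y(1) K(2) \<open>v \<notin> nbrs G v\<close> by blast
  moreover have "clique_number G - clique_number (G \<restriction> X) \<le> card (set_nbrs G X)"
    if X: "X \<subseteq> verts G" "X \<noteq> {}" for X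
  proof -
    have NX: "set_nbrs G X \<subseteq> verts G" by (auto simp: set_nbrs_def nbrs_def)
    then have cl: "closed_set_nbrs G X \<subseteq> verts G" using X by (auto simp: closed_set_nbrs_def)
    obtain L where L: "is_clique G L" "L \<subseteq> closed_set_nbrs G X"
      "card L = clique_number (G \<restriction> closed_set_nbrs G X)"
      using clique_number_induce_attained[OF finite_verts cl] .
    \<comment> \<open>As \<open>X\<close> is no basin, its closed neighbourhood contains a clique
      \<open>L\<close> of full size. The part of \<open>L\<close> inside \<open>X\<close> is bounded
      by the clique number of \<open>G \<restriction> X\<close>, and the rest lies in
      \<open>set_nbrs G X\<close>.\<close>
    have "clique_number G \<le> card L"
      using minimally_nonperfectly_divisible_no_basin[OF mnpd X(2)] X(1) L(3)
      unfolding basin_def by simp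
    also have "\<dots> \<le> card ((L \<inter> X) \<union> set_nbrs G X)"
      using L(2) finite_subset[OF X(1)] finite_subset[OF NX]
      by (intro card_mono) (auto simp: closed_set_nbrs_def)
    also have "\<dots> \<le> card (L \<inter> X) + card (set_nbrs G X)" by (rule card_Un_le)
    also have "card (L \<inter> X) \<le> clique_number (G \<restriction> X)"
      using X(1) is_clique_subset[OF L(1)]
      by (intro card_clique_le_clique_number_induce) auto
    finally show ?thesis by simp
  qed
  moreover have "clique_number G + 1 \<le> card (nbrs G v)"
  proof -
    \<comment> \<open>A non-clique has at least two vertices. They are disjoint from
      \<open>K\<close>, which contributes \<open>clique_number G - 1\<close> further neighbours of
      \<open>v\<close>.\<close>
    obtain a b where ab: "a \<in> Y" "b \<in> Y" "a \<noteq> b"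
      using Y N unfolding is_clique_def by blast
    have "card (K \<union> {a, b}) = card K + card {a, b}"
      using ab K(2) finite_subset[OF _ finN, of K] by (intro card_Un_disjoint) auto
    moreover have "card (K \<union> {a, b}) \<le> card (nbrs G v)"
      using ab Y(1) K(2) finN by (intro card_mono) auto
    ultimately show ?thesis using ab(3) K(3) Kless by simp
  qed
  ultimately show ?thesis
    using minimally_nonperfectly_divisible_no_basin[OF mnpd] no_simplicial Y(1) by blast
qed

end
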